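(* Let $\mu$ be an invariant random measure on $\mathbb{R}$ of unit intensity. If $\limsup_{n\to\infty}\mathbb{E}\big[|n-\mu([0,n))|\big]=\infty$, then $\mathfrak{c}_\infty(1)=\infty$.
   Context: Setting. $(\Omega,\mathcal{F},\mathbb{P})$ is a probability space with a measurable flow $\theta_t:\Omega\to\Omega$, $t\in\mathbb{R}$: the map $(\omega,t)\mapsto\theta_t\omega$ is measurable with respect to $\mathcal{F}\otimes\mathcal{B}(\mathbb{R})$ and $\mathcal{F}$, $\theta_0=\mathrm{Id}$, and $\theta_t\circ\theta_s=\theta_{t+s}$ for all $s,t\in\mathbb{R}$. The probability measure $\mathbb{P}$ is stationary, i.e. $\mathbb{P}\circ\theta_t=\mathbb{P}$ for all $t\in\mathbb{R}$. $\lambda$ denotes Lebesgue measure on $\mathbb{R}$, and $S_*\rho=\rho\circ S^{-1}$ denotes the push-forward of a measure $\rho$ by a map $S$. A random measure on $\mathbb{R}$ is a measurable map $\mu$ from $\Omega$ to the set of $\sigma$-finite measures on $\mathbb{R}$; one writes $\mu(\omega,A)$ or $\mu_\omega(A)$ for the mass of the Borel set $A$. It is invariant if $\mu(\theta_t\omega,A-t)=\mu(\omega,A)$ for all Borel $A\subseteq\mathbb{R}$, $t\in\mathbb{R}$, $\omega\in\Omega$. It has unit intensity if $\mathbb{E}[\mu([0,1))]=1$. Transport cost. An invariant transport map (allocation rule) is a measurable map $S:\Omega\times\mathbb{R}\to\mathbb{R}$ with $S(\theta_t\omega,s-t)=S(\omega,s)-t$ for all $s,t\in\mathbb{R}$,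 $\omega\in\Omega$. One writes $S_*\lambda=\mu$ if $\mathbb{P}$-a.s. the push-forward of $\lambda$ under $S(\omega,\cdot)$ is $\mu_\omega$, and $S(0)$ for the random variable $\omega\mapsto S(\omega,0)$. For $p>0$, $$\mathfrak{c}_\infty(p)=\inf_{S:\ S_*\lambda=\mu}\mathbb{E}\big[|S(0)|^p\big]\in[0,\infty],$$ the infimum being over invariant transport maps $S$ with $S_*\lambda=\mu$ (with $\inf\emptyset=\infty$). *)

theory Defs
  imports "HOL-Probability.Probability"
begin

text \<open>Stationarity is stated literally, \<open>\<P> \<circ> \<theta>\<^sub>t = \<P>\<close>. The image \<open>\<theta> t ` A\<close> of a
  measurable set is again measurable, being the preimage of \<open>A\<close> in \<open>space M\<close> under \<open>\<theta> (- t)\<close>.\<close>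

locale stationary_flow = prob_space M
  for M :: "'a measure" +
  fixes \<theta> :: "real \<Rightarrow> 'a \<Rightarrow> 'a"
  assumes flow_measurable: "(\<lambda>(\<omega>, t). \<theta> t \<omega>) \<in> M \<Otimes>\<^sub>M borel \<rightarrow>\<^sub>M M"
    and flow_zero: "\<And>\<omega>. \<omega> \<in> space M \<Longrightarrow> \<theta> 0 \<omega> = \<omega>"
    and flow_add: "\<And>s t \<omega>. \<omega> \<in> space M \<Longrightarrow> \<theta> t (\<theta> s \<omega>) = \<theta> (t + s) \<omega>"
    and stationary: "\<And>t A. A \<in> sets M \<Longrightarrow> emeasure M (\<theta> t ` A) = emeasure M A"

text \<open>The set of \<open>\<sigma>\<close>-finite Borel measures on the line carries the \<open>\<sigma>\<close>-algebra generated by the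
  evaluations \<open>\<nu> \<mapsto> \<nu>(A)\<close> with \<open>A\<close> Borel.\<close>

definition random_measure :: "'a measure \<Rightarrow> ('a \<Rightarrow> real measure) \<Rightarrow> bool" where
  "random_measure M \<mu> \<longleftrightarrow>
     (\<forall>\<omega>\<in>space M. sets (\<mu> \<omega>) = sets borel \<and> sigma_finite_measure (\<mu> \<omega>)) \<and>
     (\<forall>A\<in>sets borel. (\<lambda>\<omega>. emeasure (\<mu> \<omega>) A) \<in> borel_measurable M)"

definition invariant_random_measure ::
    "'a measure \<Rightarrow> (real \<Rightarrow> 'a \<Rightarrow> 'a) \<Rightarrow> ('a \<Rightarrow> real measure) \<Rightarrow> bool" where
  "invariant_random_measure M \<theta> \<mu> \<longleftrightarrow> random_measure M \<mu> \<and>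
     (\<forall>\<omega>\<in>space M. \<forall>t. \<forall>A\<in>sets borel.
        emeasure (\<mu> (\<theta> t \<omega>)) ((\<lambda>x. x - t) ` A) = emeasure (\<mu> \<omega>) A)"

definition unit_intensity :: "'a measure \<Rightarrow> ('a \<Rightarrow> real measure) \<Rightarrow> bool" where
  "unit_intensity M \<mu> \<longleftrightarrow> (\<integral>\<^sup>+\<omega>. emeasure (\<mu> \<omega>) {0..<1} \<partial>M) = 1"

definition invariant_transport_map ::
    "'a measure \<Rightarrow> (real \<Rightarrow> 'a \<Rightarrow> 'a) \<Rightarrow> ('a \<Rightarrow> real \<Rightarrow> real) \<Rightarrow> bool" where
  "invariant_transport_map M \<theta> S \<longleftrightarrow>
     (\<lambda>(\<omega>, s). S \<omega> s) \<in> borel_measurable (M \<Otimes>\<^sub>M borel) \<and>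
     (\<forall>\<omega>\<in>space M. \<forall>s t. S (\<theta> t \<omega>) (s - t) = S \<omega> s - t)"

definition transports_lebesgue_to ::
    "'a measure \<Rightarrow> ('a \<Rightarrow> real \<Rightarrow> real) \<Rightarrow> ('a \<Rightarrow> real measure) \<Rightarrow> bool" where
  "transports_lebesgue_to M S \<mu> \<longleftrightarrow> (AE \<omega> in M. distr lborel borel (S \<omega>) = \<mu> \<omega>)"

definition transport_cost ::
    "'a measure \<Rightarrow> (real \<Rightarrow> 'a \<Rightarrow> 'a) \<Rightarrow> ('a \<Rightarrow> real measure) \<Rightarrow> real \<Rightarrow> ennreal" where
  "transport_cost M \<theta> \<mu> p =
     (INF S\<in>{S. invariant_transport_map M \<theta> S \<and> transports_lebesgue_to M S \<mu>}.
        \<integral>\<^sup>+\<omega>. ennreal (\<bar>S \<omega> 0\<bar> powr p) \<partial>M)"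

text \<open>The absolute difference is taken in \<open>ereal\<close>, since \<open>\<mu> \<omega> {0..<n}\<close> may be infinite on
  a null set and subtraction on \<open>ennreal\<close> is truncated.\<close>

definition mean_discrepancy :: "'a measure \<Rightarrow> ('a \<Rightarrow> real measure) \<Rightarrow> nat \<Rightarrow> ennreal" where
  "mean_discrepancy M \<mu> n =
     (\<integral>\<^sup>+\<omega>. e2ennreal \<bar>ereal (real n) - enn2ereal (emeasure (\<mu> \<omega>) {0..<real n})\<bar> \<partial>M)"

end

theory Submission
  imports Defs
begin

text \<open>Call a site \<open>s\<close> a crossing of the level \<open>x\<close> if a transport moves it from one side of \<open>x\<close>
  to the other. If \<open>S\<close> transports Lebesgue measure to \<open>\<mu>\<close>, then \<open>\<mu>[0,n)\<close> is the length of
  \<open>S\<^sup>-\<^sup>1[0,n)\<close>, so \<open>\<bar>n - \<mu>[0,n)\<bar>\<close> is at most the length of the symmetric difference of \<open>[0,n)\<close> and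
  \<open>S\<^sup>-\<^sup>1[0,n)\<close>. A site of this symmetric difference crosses \<open>0\<close> or \<open>n\<close>
  (\<open>discrepancy_le_crossings\<close>).

  For an invariant map the expected length of the set of sites that cross a given level \<open>x\<close> does not
  depend on \<open>x\<close>; it is exactly \<open>\<E>\<bar>S(0)\<bar>\<close> (\<open>expected_crossings\<close>). By Fubini and stationarity, the
  displacement at each site \<open>s\<close> may be replaced by the displacement at \<open>0\<close>, and a rigid
  translation by \<open>a\<close> moves an interval of length \<open>\<bar>a\<bar>\<close> across any level.

  Hence \<open>\<E>\<bar>n - \<mu>[0,n)\<bar> \<le> 2 \<E>\<bar>S(0)\<bar>\<close> for every \<open>n\<close>, and a transport of finite mean cost keeps the
  mean discrepancies bounded.\<close>

definition crossings :: "(real \<Rightarrow> real) \<Rightarrow> real \<Rightarrow> real set" where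
  "crossings f x = {s. (s < x) \<noteq> (f s < x)}"

lemma crossings_measurable:
  assumes [measurable]: "f \<in> borel_measurable borel"
  shows "crossings f x \<in> sets borel"
  unfolding crossings_def by measurable

lemma emeasure_crossings_translation:
  "emeasure lborel (crossings (\<lambda>s. a + s) x) = ennreal \<bar>a\<bar>"
proof -
  have "crossings (\<lambda>s. a + s) x = (if a \<ge> 0 then {x - a..<x} else {x..<x - a})"
    by (auto simp: crossings_def)
  then show ?thesis by auto
qed

lemma abs_diff_le_ereal:
  fixes a b d :: ennreal
  assumes "a \<le> b + d" "b \<le> a + d" "a < \<infinity>"
  shows "e2ennreal \<bar>enn2ereal a - enn2ereal b\<bar> \<le> d"
proof (cases "d = \<infinity>")
  case False
  then have "b < \<infinity>"
    using assms(2,3)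
    by (metis ennreal_add_eq_top infinity_ennreal_def order.strict_trans1 less_top)
  obtain x where x: "a = ennreal x" "0 \<le> x"
    using assms(3) by (metis ennreal_cases infinity_ennreal_def less_irrefl)
  obtain y where y: "b = ennreal y" "0 \<le> y"
    using \<open>b < \<infinity>\<close> by (metis ennreal_cases infinity_ennreal_def less_irrefl)
  obtain z where z: "d = ennreal z" "0 \<le> z"
    using False by (metis ennreal_cases infinity_ennreal_def)
  have "x \<le> y + z" "y \<le> x + z"
    using assms(1,2) x y z by (simp_all del: ennreal_plus flip: ennreal_plus)
  then have "\<bar>x - y\<bar> \<le> z" by linarith
  moreover have "e2ennreal \<bar>enn2ereal a - enn2ereal b\<bar> = ennreal \<bar>x - y\<bar>"
    using x y by simp
  ultimately show ?thesis using z by (simp add: ennreal_leI)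
qed simp

text \<open>Membership in \<open>[0,n)\<close> is decided by the comparisons with \<open>0\<close> and with \<open>n\<close>, so \<open>[0,n)\<close> and
  \<open>f\<^sup>-\<^sup>1[0,n)\<close> agree off the crossings of these two levels, and the length of each set is at most
  the length of the other plus that of the crossings.\<close>

lemma discrepancy_le_crossings:
  assumes f [measurable]: "f \<in> borel_measurable borel"
  shows "e2ennreal \<bar>ereal (real n) - enn2ereal (emeasure (distr lborel borel f) {0..<real n})\<bar>
    \<le> emeasure lborel (crossings f 0) + emeasure lborel (crossings f (real n))"
proof -
  let ?I = "{0..<real n}" and ?C = "crossings f 0 \<union> crossings f (real n)"
  have C: "crossings f x \<in> sets lborel" for x
    using crossings_measurable[OF f] by simp
  have P: "f -` ?I \<in> sets lborel"
    using measurable_sets[OF f, of ?I] by simp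
  have eq: "emeasure (distr lborel borel f) ?I = emeasure lborel (f -` ?I)"
    by (simp add: emeasure_distr)
  have bound: "emeasure lborel A \<le>
      emeasure lborel B + (emeasure lborel (crossings f 0) + emeasure lborel (crossings f (real n)))"
    if "A \<subseteq> B \<union> ?C" "B \<in> sets lborel" for A B
  proof -
    have "emeasure lborel A \<le> emeasure lborel (B \<union> ?C)"
      using that C by (intro emeasure_mono) auto
    also have "\<dots> \<le> emeasure lborel B + emeasure lborel ?C"
      using that C by (intro emeasure_subadditive) auto
    also have "\<dots> \<le> emeasure lborel B +
        (emeasure lborel (crossings f 0) + emeasure lborel (crossings f (real n)))"
      using C by (intro add_left_mono emeasure_subadditive) auto
    finally show ?thesis .
  qed
  have "e2ennreal \<bar>enn2ereal (emeasure lborel ?I) - enn2ereal (emeasure lborel (f -` ?I))\<bar>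
    \<le> emeasure lborel (crossings f 0) + emeasure lborel (crossings f (real n))"
  proof (rule abs_diff_le_ereal)
    show "emeasure lborel ?I \<le> emeasure lborel (f -` ?I) +
        (emeasure lborel (crossings f 0) + emeasure lborel (crossings f (real n)))"
      using P by (intro bound) (auto simp: crossings_def)
    show "emeasure lborel (f -` ?I) \<le> emeasure lborel ?I +
        (emeasure lborel (crossings f 0) + emeasure lborel (crossings f (real n)))"
      by (intro bound) (auto simp: crossings_def)
  qed simp
  then show ?thesis by (simp add: eq)
qed

context stationary_flow
begin

lemma flow_measurable_fixed: "\<theta> t \<in> M \<rightarrow>\<^sub>M M"
proof -
  have "(\<lambda>\<omega>. (\<omega>, t)) \<in> M \<rightarrow>\<^sub>M M \<Otimes>\<^sub>M borel" by measurable
  from measurable_compose[OF this flow_measurable] show ?thesis by simp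
qed

lemma distr_flow: "distr M M (\<theta> t) = M"
proof (rule measure_eqI)
  fix A assume "A \<in> sets (distr M M (\<theta> t))"
  then have A: "A \<in> sets M" by simp
  have sp: "\<theta> u \<omega> \<in> space M" if "\<omega> \<in> space M" for u \<omega>
    using measurable_space[OF flow_measurable_fixed that] .
  have "\<theta> t -` A \<inter> space M = \<theta> (- t) ` A"
  proof (intro equalityI subsetI)
    fix \<omega> assume "\<omega> \<in> \<theta> t -` A \<inter> space M"
    then have "\<omega> = \<theta> (- t) (\<theta> t \<omega>)" "\<theta> t \<omega> \<in> A"
      by (auto simp: flow_add flow_zero)
    then show "\<omega> \<in> \<theta> (- t) ` A" by blast
  next
    fix \<omega> assume "\<omega> \<in> \<theta> (- t) ` A"
    then show "\<omega> \<in> \<theta> t -` A \<inter> space M"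
      using sets.sets_into_space[OF A] by (auto simp: flow_add flow_zero sp subset_iff)
  qed
  then show "emeasure (distr M M (\<theta> t)) A = emeasure M A"
    using A by (simp add: emeasure_distr flow_measurable_fixed stationary)
qed simp

lemma invariant_transport_map_section:
  assumes "invariant_transport_map M \<theta> S" "\<omega> \<in> space M"
  shows "S \<omega> \<in> borel_measurable borel"
proof -
  have "(\<lambda>s. (\<omega>, s)) \<in> borel \<rightarrow>\<^sub>M M \<Otimes>\<^sub>M borel" using assms(2) by measurable
  moreover have "(\<lambda>(\<omega>, s). S \<omega> s) \<in> borel_measurable (M \<Otimes>\<^sub>M borel)"
    using assms(1) by (simp add: invariant_transport_map_def)
  ultimately show ?thesis
    by (auto dest: measurable_compose)
qed

lemma crossings_integrand_measurable:
  assumes "(\<lambda>(\<omega>, s). T \<omega> s) \<in> borel_measurable (M \<Otimes>\<^sub>M borel)"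
  shows "(\<lambda>(\<omega>, s). indicator (crossings (T \<omega>) x) s :: ennreal)
    \<in> borel_measurable (M \<Otimes>\<^sub>M lborel)"
proof -
  have m [measurable]: "(\<lambda>p. T (fst p) (snd p)) \<in> borel_measurable (M \<Otimes>\<^sub>M borel)"
    using assms by (simp add: case_prod_beta')
  have sets_eq: "sets (M \<Otimes>\<^sub>M lborel) = sets (M \<Otimes>\<^sub>M borel)"
    by (simp cong: sets_pair_measure_cong)
  have "(\<lambda>(\<omega>, s). indicator (crossings (T \<omega>) x) s :: ennreal) =
      indicator {p. (snd p < x) \<noteq> (T (fst p) (snd p) < x)}"
    by (auto simp: crossings_def indicator_def fun_eq_iff)
  moreover have "indicator {p. (snd p < x) \<noteq> (T (fst p) (snd p) < x)}
      \<in> borel_measurable (M \<Otimes>\<^sub>M borel)"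
    by measurable
  ultimately show ?thesis
    by (simp add: measurable_cong_sets[OF sets_eq refl])
qed

lemma emeasure_crossings_eq:
  assumes "(\<lambda>(\<omega>, s). T \<omega> s) \<in> borel_measurable (M \<Otimes>\<^sub>M borel)" "\<omega> \<in> space M"
  shows "emeasure lborel (crossings (T \<omega>) x) = (\<integral>\<^sup>+s. indicator (crossings (T \<omega>) x) s \<partial>lborel)"
proof -
  have "(\<lambda>s. (\<omega>, s)) \<in> borel \<rightarrow>\<^sub>M M \<Otimes>\<^sub>M borel" using assms(2) by measurable
  from measurable_compose[OF this assms(1)] have "T \<omega> \<in> borel_measurable borel" by simp
  from crossings_measurable[OF this] show ?thesis by simp
qed

lemma expected_crossings_Fubini:
  assumes T: "(\<lambda>(\<omega>, s). T \<omega> s) \<in> borel_measurable (M \<Otimes>\<^sub>M borel)"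
  shows "(\<lambda>\<omega>. emeasure lborel (crossings (T \<omega>) x)) \<in> borel_measurable M"
    and "(\<integral>\<^sup>+\<omega>. emeasure lborel (crossings (T \<omega>) x) \<partial>M) =
      (\<integral>\<^sup>+s. (\<integral>\<^sup>+\<omega>. indicator (crossings (T \<omega>) x) s \<partial>M) \<partial>lborel)"
proof -
  interpret pair_sigma_finite M lborel ..
  note m = crossings_integrand_measurable[OF T, of x]
  show "(\<lambda>\<omega>. emeasure lborel (crossings (T \<omega>) x)) \<in> borel_measurable M"
    using lborel.borel_measurable_nn_integral_fst[OF m]
    by (simp add: emeasure_crossings_eq[OF T] cong: measurable_cong)
  show "(\<integral>\<^sup>+\<omega>. emeasure lborel (crossings (T \<omega>) x) \<partial>M) =
      (\<integral>\<^sup>+s. (\<integral>\<^sup>+\<omega>. indicator (crossings (T \<omega>) x) s \<partial>M) \<partial>lborel)"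
    using Fubini'[OF m] by (simp add: emeasure_crossings_eq[OF T] cong: nn_integral_cong)
qed

text \<open>By invariance the displacement at site \<open>s\<close> is the displacement at the origin seen from
  \<open>\<theta> s\<close>, so for each fixed \<open>s\<close> the map \<open>S\<close> crosses \<open>x\<close> with the same probability as the rigid
  translation by the random amount \<open>S(0)\<close>. Only one-site probabilities enter the expected
  length, so exchanging the two integrals transfers it to the translation.\<close>

lemma expected_crossings:
  assumes S: "invariant_transport_map M \<theta> S"
  shows "(\<integral>\<^sup>+\<omega>. emeasure lborel (crossings (S \<omega>) x) \<partial>M) = (\<integral>\<^sup>+\<omega>. ennreal \<bar>S \<omega> 0\<bar> \<partial>M)"
proof -
  have mS: "(\<lambda>(\<omega>, s). S \<omega> s) \<in> borel_measurable (M \<Otimes>\<^sub>M borel)"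
    using S by (simp add: invariant_transport_map_def)
  have "(\<lambda>\<omega>. (\<omega>, 0::real)) \<in> M \<rightarrow>\<^sub>M M \<Otimes>\<^sub>M borel" by measurable
  from measurable_compose[OF this mS]
  have S0 [measurable]: "(\<lambda>\<omega>. S \<omega> 0) \<in> borel_measurable M" by simp
  have mT: "(\<lambda>(\<omega>, s). S \<omega> 0 + s) \<in> borel_measurable (M \<Otimes>\<^sub>M borel)"
    by measurable
  have one_site: "(\<integral>\<^sup>+\<omega>. indicator (crossings (S \<omega>) x) s \<partial>M) =
      (\<integral>\<^sup>+\<omega>. indicator (crossings (\<lambda>s. S \<omega> 0 + s) x) s \<partial>M)" for s
  proof -
    let ?g = "\<lambda>\<omega>. indicator (crossings (\<lambda>s. S \<omega> 0 + s) x) s :: ennreal"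
    have "(\<lambda>\<omega>. (\<omega>, s)) \<in> M \<rightarrow>\<^sub>M M \<Otimes>\<^sub>M lborel" by measurable
    from measurable_compose[OF this crossings_integrand_measurable[OF mT]]
    have g: "?g \<in> borel_measurable M" by simp
    have "S \<omega> s = S (\<theta> s \<omega>) 0 + s" if "\<omega> \<in> space M" for \<omega>
    proof -
      have "S (\<theta> s \<omega>) (s - s) = S \<omega> s - s"
        using S that unfolding invariant_transport_map_def by blast
      then show ?thesis by simp
    qed
    then have "(\<integral>\<^sup>+\<omega>. indicator (crossings (S \<omega>) x) s \<partial>M) = (\<integral>\<^sup>+\<omega>. ?g (\<theta> s \<omega>) \<partial>M)"
      by (intro nn_integral_cong) (simp add: crossings_def indicator_def)
    also have "\<dots> = (\<integral>\<^sup>+\<omega>. ?g \<omega> \<partial>distr M M (\<theta> s))"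
      using g by (simp add: nn_integral_distr flow_measurable_fixed)
    finally show ?thesis by (simp add: distr_flow)
  qed
  have "(\<integral>\<^sup>+\<omega>. emeasure lborel (crossings (S \<omega>) x) \<partial>M) =
      (\<integral>\<^sup>+\<omega>. emeasure lborel (crossings (\<lambda>s. S \<omega> 0 + s) x) \<partial>M)"
    by (simp only: expected_crossings_Fubini(2)[OF mS] expected_crossings_Fubini(2)[OF mT] one_site)
  then show ?thesis by (simp only: emeasure_crossings_translation)
qed

lemma mean_discrepancy_le_twice_cost:
  assumes S: "invariant_transport_map M \<theta> S" and \<mu>: "transports_lebesgue_to M S \<mu>"
  shows "mean_discrepancy M \<mu> n \<le> 2 * (\<integral>\<^sup>+\<omega>. ennreal \<bar>S \<omega> 0\<bar> \<partial>M)"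
proof -
  have "mean_discrepancy M \<mu> n \<le> (\<integral>\<^sup>+\<omega>. emeasure lborel (crossings (S \<omega>) 0) +
      emeasure lborel (crossings (S \<omega>) (real n)) \<partial>M)"
    unfolding mean_discrepancy_def
  proof (rule nn_integral_mono_AE)
    show "AE \<omega> in M. e2ennreal \<bar>ereal (real n) - enn2ereal (emeasure (\<mu> \<omega>) {0..<real n})\<bar>
      \<le> emeasure lborel (crossings (S \<omega>) 0) + emeasure lborel (crossings (S \<omega>) (real n))"
      using \<mu>[unfolded transports_lebesgue_to_def] AE_space
    proof eventually_elim
      case (elim \<omega>)
      show ?case
        using discrepancy_le_crossings[OF invariant_transport_map_section[OF S elim(2)], of n]
        by (simp only: elim(1))
    qed
  qed
  also have "\<dots> = (\<integral>\<^sup>+\<omega>. ennreal \<bar>S \<omega> 0\<bar> \<partial>M) + (\<integral>\<^sup>+\<omega>. ennreal \<bar>S \<omega> 0\<bar> \<partial>M)"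
    using S by (subst nn_integral_add)
      (auto simp: expected_crossings invariant_transport_map_def
        intro!: expected_crossings_Fubini(1))
  finally show ?thesis by (simp add: mult_2)
qed

end

theorem theorem1p3:
  fixes M :: "'a measure" and \<theta> :: "real \<Rightarrow> 'a \<Rightarrow> 'a" and \<mu> :: "'a \<Rightarrow> real measure"
  assumes "stationary_flow M \<theta>"
    and "invariant_random_measure M \<theta> \<mu>"
    and "unit_intensity M \<mu>"
    and "limsup (\<lambda>n. mean_discrepancy M \<mu> n) = \<infinity>"
  shows "transport_cost M \<theta> \<mu> 1 = \<infinity>"
proof -
  interpret stationary_flow M \<theta> by fact
  have "(\<integral>\<^sup>+\<omega>. ennreal (\<bar>S \<omega> 0\<bar> powr 1) \<partial>M) = \<infinity>"
    if S: "invariant_transport_map M \<theta> S" "transports_lebesgue_to M S \<mu>" for S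
  proof -
    have "limsup (\<lambda>n. mean_discrepancy M \<mu> n) \<le> 2 * (\<integral>\<^sup>+\<omega>. ennreal \<bar>S \<omega> 0\<bar> \<partial>M)"
      using mean_discrepancy_le_twice_cost[OF S] by (intro Limsup_bounded always_eventually) simp
    with assms(4) have "2 * (\<integral>\<^sup>+\<omega>. ennreal \<bar>S \<omega> 0\<bar> \<partial>M) = \<infinity>"
      by (simp add: top_unique)
    then show ?thesis by (auto simp: ennreal_mult_eq_top_iff)
  qed
  then show ?thesis
    unfolding transport_cost_def by (intro INF_eqI) (auto simp: top_unique)
qed

end
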